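(* Let $p=(12,R)$ be the mesh pattern with $R=\{(0,0),(0,1),(1,0),(1,1),(1,2),(2,1),(2,2)\}$. Let $F(x)=\sum_{n\ge0}n!\,x^n$, $F(x,q)=\sum_{n\ge 0}x^n\sum_{\pi\in S_n}q^{p(\pi)}$, and $A(x)=\sum_{n\ge0}|S_n(p)|x^n$. Then, as formal power series in $x$, $$A(x)= \frac{F(x)}{1+x^2F(x)},\qquad F(x,q)=\frac{F(x)}{1+(1-q)x^2F(x)}.$$
   Context: $S_n$ is the set of permutations $\pi=\pi_1\cdots\pi_n$ of $\{1,\dots,n\}$ ($S_0$ contains only the empty permutation). A mesh pattern $(12,R)$ consists of the permutation $12$ and a set $R\subseteq\{0,1,2\}\times\{0,1,2\}$ of shaded boxes. An occurrence of $(12,R)$ in $\pi\in S_n$ is a pair of positions $s<t$ with $\pi_s<\pi_t$ such that, putting $s_0=0,\ s_1=s,\ s_2=t,\ s_3=n+1$ and $v_0=0,\ v_1=\pi_s,\ v_2=\pi_t,\ v_3=n+1$, for every $(i,j)\in R$ there is no position $m$ with $s_i<m<s_{i+1}$ and $v_j<\pi_m<v_{j+1}$. $p(\pi)$ is the number of occurrences of $p$ in $\pi$, and $S_n(p)$ is the set of $\pi\in S_n$ with $p(\pi)=0$ (permutations avoiding $p$). *)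

theory Defs
  imports
    "HOL-Combinatorics.Permutations"
    "HOL-Computational_Algebra.Formal_Power_Series"
    "HOL-Computational_Algebra.Polynomial_Factorial"
begin

text \<open>
  A permutation of \<open>{1..n}\<close> is a function \<open>\<pi> :: nat \<Rightarrow> nat\<close> with \<open>\<pi> permutes {1..n}\<close>
  (the identity outside \<open>{1..n}\<close>), so its one-line notation is \<open>\<pi> 1, \<dots>, \<pi> n\<close>.
\<close>

definition perms :: "nat \<Rightarrow> (nat \<Rightarrow> nat) set" where
  "perms n = {\<pi>. \<pi> permutes {1..n}}"

text \<open>
  Mesh patterns whose underlying permutation is 12, given by their set \<open>R\<close> of shaded boxes;
  \<open>[0, s, t, n + 1]\<close> and \<open>[0, \<pi> s, \<pi> t, n + 1]\<close> are the vertical and horizontal grid lines.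
  Only sets \<open>R \<subseteq> {0, 1, 2} \<times> {0, 1, 2}\<close> are meaningful.
\<close>

definition mesh12_occurrences ::
    "(nat \<times> nat) set \<Rightarrow> nat \<Rightarrow> (nat \<Rightarrow> nat) \<Rightarrow> (nat \<times> nat) set" where
  "mesh12_occurrences R n \<pi> =
    {(s, t). s \<in> {1..n} \<and> t \<in> {1..n} \<and> s < t \<and> \<pi> s < \<pi> t \<and>
      (\<forall>(i, j) \<in> R. \<not> (\<exists>m \<in> {1..n}.
          [0, s, t, n + 1] ! i < m \<and> m < [0, s, t, n + 1] ! (i + 1) \<and>
          [0, \<pi> s, \<pi> t, n + 1] ! j < \<pi> m \<and> \<pi> m < [0, \<pi> s, \<pi> t, n + 1] ! (j + 1)))}"

definition mesh12_count :: "(nat \<times> nat) set \<Rightarrow> nat \<Rightarrow> (nat \<Rightarrow> nat) \<Rightarrow> nat" where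
  "mesh12_count R n \<pi> = card (mesh12_occurrences R n \<pi>)"

definition mesh12_avoiders :: "(nat \<times> nat) set \<Rightarrow> nat \<Rightarrow> (nat \<Rightarrow> nat) set" where
  "mesh12_avoiders R n = {\<pi> \<in> perms n. mesh12_count R n \<pi> = 0}"

definition perms_fps :: "'a::comm_ring_1 fps" where
  "perms_fps = Abs_fps (\<lambda>n. of_nat (fact n))"

definition mesh12_avoiders_fps :: "(nat \<times> nat) set \<Rightarrow> 'a::comm_ring_1 fps" where
  "mesh12_avoiders_fps R = Abs_fps (\<lambda>n. of_nat (card (mesh12_avoiders R n)))"

definition mesh12_distribution_fps :: "(nat \<times> nat) set \<Rightarrow> 'a::comm_ring_1 \<Rightarrow> 'a fps" where
  "mesh12_distribution_fps R q = Abs_fps (\<lambda>n. \<Sum>\<pi>\<in>perms n. q ^ mesh12_count R n \<pi>)"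

text \<open>
  The indeterminate \<open>q\<close> of the polynomial ring over the integers, viewed in its field of fractions,
  over which power series have a division; power series over the polynomial ring embed into
  power series over that field.
\<close>

definition q_var :: "int poly fract" where
  "q_var = to_fract [:0, 1:]"

end

theory Submission
  imports Defs
begin

text \<open>
  The shading leaves only the boxes \<open>(0, 2)\<close> and \<open>(2, 0)\<close> free, so an occurrence of the pattern is
  a pair of adjacent positions \<open>s\<close>, \<open>s + 1\<close> with an ascent, everything to the left lying above both
  entries and everything to the right lying below both. Counting entries on either side forces the
  two values to be consecutive too: \<open>\<pi>\<close> is a skew sum \<open>\<sigma> \<ominus> 12 \<ominus> \<tau>\<close>, where \<open>\<sigma>\<close> permutes
  \<open>k = s - 1\<close> letters and \<open>\<tau>\<close> the remaining \<open>l = n - k - 2\<close>. The pattern thus counts the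
  components equal to \<open>12\<close> in the skew-sum decomposition.

  Write \<open>D\<close> for the distribution series and \<open>F\<close> for \<open>perms_fps\<close>. Instead of the full decomposition into
  indecomposables, the proof uses a telescoping identity: if \<open>c\<close> is the number of occurrences in
  \<open>\<pi>\<close>, then
  \<open>q ^ c = 1 + (q - 1) * (1 + q + \<dots> + q ^ (c - 1))\<close>,
  and the summand \<open>q ^ i\<close> is attributed to the occurrence having exactly \<open>i\<close> occurrences to its left
  (\<open>power_card_telescope\<close>). Summing over all \<open>\<pi>\<close> therefore means summing over permutations with
  one marked occurrence, that is, over pairs \<open>(\<sigma>, \<tau>)\<close>; the occurrences to the left of the marked one
  are exactly those of \<open>\<sigma>\<close> (\<open>earlier_blocks_glue\<close>), while \<open>\<tau>\<close> is arbitrary. This gives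
  \<open>D = F + (q - 1) x\<^sup>2 D F\<close>, which is the distribution formula; the avoiders are the case \<open>q = 0\<close>.
\<close>

section \<open>Occurrences as skew-sum components\<close>

text \<open>
  Positions \<open>s\<close> at which a component \<open>12\<close> of the skew-sum decomposition begins. The two values are
  given explicitly, as functions of \<open>n\<close> and \<open>s\<close>, so that membership can be followed through the
  shift of positions and values that a skew sum causes.
\<close>

definition ascent_blocks :: "nat \<Rightarrow> (nat \<Rightarrow> nat) \<Rightarrow> nat set" where
  "ascent_blocks n \<pi> = {s. 1 \<le> s \<and> s + 1 \<le> n \<and> \<pi> s = n - s \<and> \<pi> (s + 1) = n - s + 1 \<and>
     (\<forall>m\<in>{1..<s}. n - s + 1 < \<pi> m) \<and> (\<forall>m\<in>{s+2..n}. \<pi> m < n - s)}"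

lemma finite_ascent_blocks [simp]: "finite (ascent_blocks n \<pi>)"
  by (rule finite_subset[of _ "{..n}"]) (auto simp: ascent_blocks_def)

lemma finite_perms [simp]: "finite (perms n)"
  by (simp add: perms_def finite_permutations)

lemma card_perms: "card (perms n) = fact n"
  unfolding perms_def by (rule card_permutations) auto

lemma permsI:
  assumes "inj_on \<pi> {1..n}" "\<And>m. m \<in> {1..n} \<Longrightarrow> \<pi> m \<in> {1..n}" "\<And>m. m \<notin> {1..n} \<Longrightarrow> \<pi> m = m"
  shows "\<pi> \<in> perms n"
proof -
  have "\<pi> ` {1..n} = {1..n}"
    using assms by (intro endo_inj_surj) auto
  then show ?thesis
    using assms unfolding perms_def by (auto intro!: bij_imp_permutes simp: bij_betw_def)
qed

lemma perms_in: "\<pi> \<in> perms n \<Longrightarrow> 1 \<le> m \<Longrightarrow> m \<le> n \<Longrightarrow> 1 \<le> \<pi> m \<and> \<pi> m \<le> n"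
  using permutes_in_image[of \<pi> "{1..n}" m] by (auto simp: perms_def)

lemma perms_outside: "\<pi> \<in> perms n \<Longrightarrow> m \<notin> {1..n} \<Longrightarrow> \<pi> m = m"
  by (auto simp: perms_def dest: permutes_not_in)

lemma perms_eq_iff: "\<pi> \<in> perms n \<Longrightarrow> \<pi> a = \<pi> b \<longleftrightarrow> a = b"
  by (auto simp: perms_def dest: permutes_inj injD)

lemma perms_inj_on: "\<pi> \<in> perms n \<Longrightarrow> inj_on \<pi> A"
  by (auto simp: inj_on_def perms_eq_iff)

text \<open>
  The middle column is shaded in all three rows, so an entry strictly between \<open>s\<close> and \<open>t\<close> would have
  no box to lie in. Left of \<open>s\<close> only the top row is free, right of \<open>t\<close> only the bottom row.
\<close>

lemma mesh12_occurrences_iff: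
  assumes R: "R = {(0, 0), (0, 1), (1, 0), (1, 1), (1, 2), (2, 1), (2, 2)}"
    and \<pi>: "\<pi> \<in> perms n"
  shows "(s, t) \<in> mesh12_occurrences R n \<pi> \<longleftrightarrow>
    1 \<le> s \<and> s < t \<and> t \<le> n \<and> \<pi> s < \<pi> t \<and>
    (\<forall>m\<in>{1..<s}. \<pi> t < \<pi> m) \<and> t = s + 1 \<and> (\<forall>m\<in>{t+1..n}. \<pi> m < \<pi> s)"
    (is "?L \<longleftrightarrow> ?R")
proof -
  have range: "0 < \<pi> m" "\<pi> m < n + 1" if "m \<in> {1..n}" for m
    using that perms_in[OF \<pi>, of m] by auto
  \<comment> \<open>One conjunct per shaded box; the outer grid lines \<open>0\<close> and \<open>n + 1\<close> impose no constraint.\<close>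
  have L: "?L \<longleftrightarrow> s \<in> {1..n} \<and> t \<in> {1..n} \<and> s < t \<and> \<pi> s < \<pi> t \<and>
      (\<forall>m\<in>{1..n}. \<not> (m < s \<and> \<pi> m < \<pi> s) \<and> \<not> (m < s \<and> \<pi> s < \<pi> m \<and> \<pi> m < \<pi> t) \<and>
        \<not> (s < m \<and> m < t \<and> \<pi> m < \<pi> s) \<and> \<not> (s < m \<and> m < t \<and> \<pi> s < \<pi> m \<and> \<pi> m < \<pi> t) \<and>
        \<not> (s < m \<and> m < t \<and> \<pi> t < \<pi> m) \<and>
        \<not> (t < m \<and> \<pi> s < \<pi> m \<and> \<pi> m < \<pi> t) \<and> \<not> (t < m \<and> \<pi> t < \<pi> m))"
    (is "_ \<longleftrightarrow> _ \<and> _ \<and> _ \<and> _ \<and> (\<forall>m\<in>_. ?C m)")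
  proof -
    have "(\<forall>(i, j)\<in>R. \<not> (\<exists>m\<in>{1..n}.
          [0, s, t, n + 1] ! i < m \<and> m < [0, s, t, n + 1] ! (i + 1) \<and>
          [0, \<pi> s, \<pi> t, n + 1] ! j < \<pi> m \<and> \<pi> m < [0, \<pi> s, \<pi> t, n + 1] ! (j + 1)))
      \<longleftrightarrow> (\<forall>m\<in>{1..n}. \<forall>(i, j)\<in>R. \<not> (
          [0, s, t, n + 1] ! i < m \<and> m < [0, s, t, n + 1] ! (i + 1) \<and>
          [0, \<pi> s, \<pi> t, n + 1] ! j < \<pi> m \<and> \<pi> m < [0, \<pi> s, \<pi> t, n + 1] ! (j + 1)))"
      by blast
    also have "\<dots> \<longleftrightarrow> (\<forall>m\<in>{1..n}. ?C m)"
    proof (rule ball_cong[OF refl])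
      fix m assume "m \<in> {1..n}"
      with range[OF this] show "(\<forall>(i, j)\<in>R. \<not> (
          [0, s, t, n + 1] ! i < m \<and> m < [0, s, t, n + 1] ! (i + 1) \<and>
          [0, \<pi> s, \<pi> t, n + 1] ! j < \<pi> m \<and> \<pi> m < [0, \<pi> s, \<pi> t, n + 1] ! (j + 1))) \<longleftrightarrow> ?C m"
        unfolding R by (simp add: numeral_2_eq_2) blast
    qed
    finally show ?thesis
      by (simp only: mesh12_occurrences_def mem_Collect_eq prod.case)
  qed
  show ?thesis
  proof
    assume ?L
    then have st: "1 \<le> s" "s < t" "t \<le> n" "\<pi> s < \<pi> t" and B: "\<And>m. m \<in> {1..n} \<Longrightarrow> ?C m"
      unfolding L by simp_all
    have neq: "\<pi> m \<noteq> \<pi> s" "\<pi> m \<noteq> \<pi> t" if "m \<noteq> s" "m \<noteq> t" for m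
      using that by (auto simp: perms_eq_iff[OF \<pi>])
    have "t = s + 1"
    proof (rule ccontr)
      assume "t \<noteq> s + 1"
      with st B[of "s + 1"] neq[of "s + 1"] show False by auto
    qed
    moreover have "\<pi> t < \<pi> m" if "m \<in> {1..<s}" for m
      using that st B[of m] neq[of m] by auto
    moreover have "\<pi> m < \<pi> s" if "m \<in> {t+1..n}" for m
      using that st B[of m] neq[of m] by auto
    ultimately show ?R using st by blast
  next
    assume ?R
    then have st: "1 \<le> s" "t = s + 1" "t \<le> n" "\<pi> s < \<pi> t"
      and left: "\<And>m. m \<in> {1..<s} \<Longrightarrow> \<pi> t < \<pi> m" and right: "\<And>m. m \<in> {t+1..n} \<Longrightarrow> \<pi> m < \<pi> s"
      by auto
    have "?C m" if m: "m \<in> {1..n}" for m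
    proof -
      consider "m < s" | "m = s" | "m = t" | "t < m"
        using st by linarith
      then show ?thesis
        using m st left[of m] right[of m] by cases auto
    qed
    with st show ?L
      unfolding L by simp
  qed
qed

text \<open>
  The values are forced by pigeonhole: the \<open>s - 1\<close> entries on the left fit into the values above
  \<open>\<pi> t\<close>, and the \<open>n - t\<close> entries on the right into those below \<open>\<pi> s\<close>. Since \<open>\<pi> s < \<pi> t\<close> and only
  two positions remain, neither estimate has any slack.
\<close>

lemma mesh12_occurrences_conv_blocks:
  assumes R: "R = {(0, 0), (0, 1), (1, 0), (1, 1), (1, 2), (2, 1), (2, 2)}"
    and \<pi>: "\<pi> \<in> perms n"
  shows "mesh12_occurrences R n \<pi> = (\<lambda>s. (s, s + 1)) ` ascent_blocks n \<pi>"
proof (intro equalityI subsetI)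
  fix p assume "p \<in> mesh12_occurrences R n \<pi>"
  moreover obtain s t where p: "p = (s, t)" by (cases p)
  ultimately have st: "1 \<le> s" "s < t" "t \<le> n" "\<pi> s < \<pi> t" "t = s + 1"
    and left: "\<And>m. m \<in> {1..<s} \<Longrightarrow> \<pi> t < \<pi> m"
    and right: "\<And>m. m \<in> {t+1..n} \<Longrightarrow> \<pi> m < \<pi> s"
    using mesh12_occurrences_iff[OF assms, of s t] by blast+
  have "card {1..<s} \<le> card {\<pi> t + 1..n}"
    using perms_in[OF \<pi>] left st
    by (intro card_inj_on_le[OF perms_inj_on[OF \<pi>]]) (auto simp: Suc_le_eq)
  moreover have "card {t+1..n} \<le> card {1..<\<pi> s}"
    using perms_in[OF \<pi>] right st
    by (intro card_inj_on_le[OF perms_inj_on[OF \<pi>]]) (auto simp: Suc_le_eq)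
  ultimately have "\<pi> s = n - s" "\<pi> t = n - s + 1"
    using st perms_in[OF \<pi>, of s] perms_in[OF \<pi>, of t] by auto
  then have "s \<in> ascent_blocks n \<pi>"
    unfolding ascent_blocks_def using left right st by auto
  then show "p \<in> (\<lambda>s. (s, s + 1)) ` ascent_blocks n \<pi>"
    using p st by blast
next
  fix p assume "p \<in> (\<lambda>s. (s, s + 1)) ` ascent_blocks n \<pi>"
  then show "p \<in> mesh12_occurrences R n \<pi>"
    by (auto simp: mesh12_occurrences_iff[OF assms] ascent_blocks_def)
qed

lemma mesh12_count_conv_blocks:
  assumes "R = {(0, 0), (0, 1), (1, 0), (1, 1), (1, 2), (2, 1), (2, 2)}" "\<pi> \<in> perms n"
  shows "mesh12_count R n \<pi> = card (ascent_blocks n \<pi>)"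
  unfolding mesh12_count_def mesh12_occurrences_conv_blocks[OF assms]
  by (rule card_image) (auto simp: inj_on_def)

section \<open>Splitting a permutation at a block\<close>

text \<open>The skew sum \<open>\<sigma> \<ominus> 12 \<ominus> \<tau>\<close> for \<open>\<sigma>\<close> of length \<open>k\<close> and \<open>\<tau>\<close> of length \<open>l\<close>.\<close>

definition glue :: "nat \<Rightarrow> nat \<Rightarrow> (nat \<Rightarrow> nat) \<Rightarrow> (nat \<Rightarrow> nat) \<Rightarrow> nat \<Rightarrow> nat" where
  "glue k l \<sigma> \<tau> m =
     (if m \<in> {1..k} then \<sigma> m + (l + 2)
      else if m = k + 1 then l + 1
      else if m = k + 2 then l + 2
      else if m \<in> {k+3..k+l+2} then \<tau> (m - (k + 2))
      else m)"

text \<open>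
  Inverse to \<open>glue\<close>. The left factor carries the upper values, which need shifting down; in the right
  factor only the positions shift. Outside their range both parts are the identity, as membership in
  \<open>perms\<close> demands.
\<close>

definition upper_part :: "nat \<Rightarrow> nat \<Rightarrow> (nat \<Rightarrow> nat) \<Rightarrow> nat \<Rightarrow> nat" where
  "upper_part k l \<pi> m = (if m \<in> {1..k} then \<pi> m - (l + 2) else m)"

definition lower_part :: "nat \<Rightarrow> nat \<Rightarrow> (nat \<Rightarrow> nat) \<Rightarrow> nat \<Rightarrow> nat" where
  "lower_part k l \<pi> m = (if m \<in> {1..l} then \<pi> (m + (k + 2)) else m)"

lemma glue_in_perms:
  assumes \<sigma>: "\<sigma> \<in> perms k" and \<tau>: "\<tau> \<in> perms l"
  shows "glue k l \<sigma> \<tau> \<in> perms (k + l + 2)"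
proof (rule permsI)
  have lower_range: "1 \<le> \<tau> (m - (k + 2)) \<and> \<tau> (m - (k + 2)) \<le> l" if "m \<in> {k+3..k+l+2}" for m
    using that by (intro perms_in[OF \<tau>]) auto
  have upper: "l + 3 \<le> glue k l \<sigma> \<tau> m \<and> glue k l \<sigma> \<tau> m \<le> k + l + 2" if "m \<in> {1..k}" for m
    using that perms_in[OF \<sigma>, of m] by (auto simp: glue_def)
  have lower: "1 \<le> glue k l \<sigma> \<tau> m \<and> glue k l \<sigma> \<tau> m \<le> l" if "m \<in> {k+3..k+l+2}" for m
    using that lower_range[of m] by (auto simp: glue_def)
  have middle: "glue k l \<sigma> \<tau> (k + 1) = l + 1" "glue k l \<sigma> \<tau> (k + 2) = l + 2"
    by (auto simp: glue_def)
  have cases: "m \<in> {1..k} \<or> m = k + 1 \<or> m = k + 2 \<or> m \<in> {k+3..k+l+2}" if "m \<in> {1..k+l+2}" for m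
    using that by auto
  show "glue k l \<sigma> \<tau> m \<in> {1..k + l + 2}" if "m \<in> {1..k + l + 2}" for m
    using cases[OF that] upper[of m] lower[of m] middle by auto
  show "inj_on (glue k l \<sigma> \<tau>) {1..k + l + 2}"
  proof (rule linorder_inj_onI')
    fix a b assume ab: "a \<in> {1..k + l + 2}" "b \<in> {1..k + l + 2}" "a < b"
    show "glue k l \<sigma> \<tau> a \<noteq> glue k l \<sigma> \<tau> b"
    proof (cases "(a \<in> {1..k} \<and> b \<in> {1..k}) \<or> (a \<in> {k+3..k+l+2} \<and> b \<in> {k+3..k+l+2})")
      case True
      then show ?thesis
        using ab perms_eq_iff[OF \<sigma>, of a b] perms_eq_iff[OF \<tau>, of "a - (k + 2)" "b - (k + 2)"]
        by (auto simp: glue_def)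
    next
      case False
      then show ?thesis
        using cases[OF ab(1)] cases[OF ab(2)] upper[of a] upper[of b] lower[of a] lower[of b] middle ab
        by fastforce
    qed
  qed
qed (auto simp: glue_def)

lemma glue_block:
  assumes \<sigma>: "\<sigma> \<in> perms k" and \<tau>: "\<tau> \<in> perms l"
  shows "k + 1 \<in> ascent_blocks (k + l + 2) (glue k l \<sigma> \<tau>)"
proof -
  have lower_range: "1 \<le> \<tau> (m - (k + 2)) \<and> \<tau> (m - (k + 2)) \<le> l" if "m \<in> {k+3..k+l+2}" for m
    using that by (intro perms_in[OF \<tau>]) auto
  have "l + 2 < glue k l \<sigma> \<tau> m" if "m \<in> {1..<k+1}" for m
    using that perms_in[OF \<sigma>, of m] by (auto simp: glue_def)
  moreover have "glue k l \<sigma> \<tau> m < l + 1" if "m \<in> {k+3..k+l+2}" for m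
    using that lower_range[of m] by (auto simp: glue_def)
  ultimately show ?thesis
    by (auto simp: ascent_blocks_def glue_def[of k l \<sigma> \<tau> "Suc k"] glue_def[of k l \<sigma> \<tau> "Suc (Suc k)"])
qed

lemma block_values:
  assumes "k + 1 \<in> ascent_blocks (k + l + 2) \<pi>"
  shows "\<pi> (k + 1) = l + 1" "\<pi> (k + 2) = l + 2"
    "\<And>m. m \<in> {1..k} \<Longrightarrow> l + 2 < \<pi> m" "\<And>m. m \<in> {k+3..k+l+2} \<Longrightarrow> \<pi> m < l + 1"
  using assms by (auto simp: ascent_blocks_def numeral_eq_Suc)

lemma parts_in_perms:
  assumes \<pi>: "\<pi> \<in> perms (k + l + 2)" and b: "k + 1 \<in> ascent_blocks (k + l + 2) \<pi>"
  shows "upper_part k l \<pi> \<in> perms k" "lower_part k l \<pi> \<in> perms l"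
proof -
  note v = block_values[OF b]
  show "upper_part k l \<pi> \<in> perms k"
  proof (rule permsI)
    show "inj_on (upper_part k l \<pi>) {1..k}"
    proof (rule inj_onI)
      fix a b assume ab: "a \<in> {1..k}" "b \<in> {1..k}" "upper_part k l \<pi> a = upper_part k l \<pi> b"
      then have "\<pi> a = \<pi> b"
        using v(3)[of a] v(3)[of b] by (auto simp: upper_part_def)
      then show "a = b" by (simp add: perms_eq_iff[OF \<pi>])
    qed
    show "upper_part k l \<pi> m \<in> {1..k}" if "m \<in> {1..k}" for m
      using that v(3)[of m] perms_in[OF \<pi>, of m] by (auto simp: upper_part_def)
  qed (auto simp: upper_part_def)
  show "lower_part k l \<pi> \<in> perms l"
  proof (rule permsI)
    show "inj_on (lower_part k l \<pi>) {1..l}"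
      by (auto simp: inj_on_def lower_part_def perms_eq_iff[OF \<pi>])
    show "lower_part k l \<pi> m \<in> {1..l}" if "m \<in> {1..l}" for m
      using that v(4)[of "m + (k + 2)"] perms_in[OF \<pi>, of "m + (k + 2)"] by (auto simp: lower_part_def)
  qed (auto simp: lower_part_def)
qed

lemma glue_parts:
  assumes \<pi>: "\<pi> \<in> perms (k + l + 2)" and b: "k + 1 \<in> ascent_blocks (k + l + 2) \<pi>"
  shows "glue k l (upper_part k l \<pi>) (lower_part k l \<pi>) = \<pi>"
proof
  fix m
  show "glue k l (upper_part k l \<pi>) (lower_part k l \<pi>) m = \<pi> m"
  proof (cases "m \<in> {1..k} \<or> m \<in> {k+3..k+l+2}")
    case True
    then show ?thesis
    proof
      assume "m \<in> {1..k}"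
      then show ?thesis
        using block_values(3)[OF b, of m] by (simp add: glue_def upper_part_def)
    next
      assume "m \<in> {k+3..k+l+2}"
      then obtain j where "m = j + (k + 2)" "j \<in> {1..l}"
        by (intro that[of "m - (k + 2)"]) auto
      then show ?thesis
        by (simp add: glue_def lower_part_def)
    qed
  next
    case False
    then show ?thesis
      using block_values(1,2)[OF b] perms_outside[OF \<pi>, of m]
      by (auto simp: glue_def)
  qed
qed

lemma parts_glue:
  assumes "\<sigma> \<in> perms k" "\<tau> \<in> perms l"
  shows "upper_part k l (glue k l \<sigma> \<tau>) = \<sigma>" "lower_part k l (glue k l \<sigma> \<tau>) = \<tau>"
  using perms_outside[OF assms(1)] perms_outside[OF assms(2)]
  by (auto simp: fun_eq_iff glue_def upper_part_def lower_part_def)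

text \<open>
  Shifting all values by \<open>l + 2\<close> turns the conditions on a block of \<open>\<sigma>\<close> into those on a block of the
  skew sum, because \<open>k + l + 2 - u = (k - u) + (l + 2)\<close>, and the entries appended after \<open>\<sigma>\<close> are
  smaller than everything in \<open>\<sigma>\<close>. The only new candidate left of \<open>k + 1\<close> is \<open>u = k\<close>, which would
  have to use the entry at \<open>k + 1\<close>; that entry is too small to form an ascent with its predecessor.
\<close>

lemma earlier_blocks_glue:
  assumes \<sigma>: "\<sigma> \<in> perms k" and \<tau>: "\<tau> \<in> perms l"
  shows "{u \<in> ascent_blocks (k + l + 2) (glue k l \<sigma> \<tau>). u < k + 1} = ascent_blocks k \<sigma>"
proof (intro equalityI subsetI)
  let ?\<pi> = "glue k l \<sigma> \<tau>"
  have lower_range: "1 \<le> \<tau> (m - (k + 2)) \<and> \<tau> (m - (k + 2)) \<le> l" if "m \<in> {k+3..k+l+2}" for m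
    using that by (intro perms_in[OF \<tau>]) auto
  have upper: "?\<pi> m = \<sigma> m + (l + 2)" if "1 \<le> m" "m \<le> k" for m
    using that by (simp add: glue_def)
  have mid: "?\<pi> (k + 1) = l + 1" "?\<pi> (k + 2) = l + 2" by (auto simp: glue_def)
  have lower: "?\<pi> m \<le> l + 2" if "m \<in> {k+1..k+l+2}" for m
    using that lower_range[of m] by (auto simp: glue_def)
  {
    fix u assume "u \<in> {u \<in> ascent_blocks (k + l + 2) ?\<pi>. u < k + 1}"
    then have u: "1 \<le> u" "u \<le> k" "?\<pi> u = k + l + 2 - u" "?\<pi> (u + 1) = k + l + 2 - u + 1"
      and left: "\<And>m. m \<in> {1..<u} \<Longrightarrow> k + l + 2 - u + 1 < ?\<pi> m"
      and right: "\<And>m. m \<in> {u+2..k+l+2} \<Longrightarrow> ?\<pi> m < k + l + 2 - u"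
      by (auto simp: ascent_blocks_def)
    have "u \<noteq> k" using u mid by auto
    with u have uk: "u + 1 \<le> k" by simp
    have "k - u + 1 < \<sigma> m" if "m \<in> {1..<u}" for m
      using left[OF that] upper[of m] that uk by auto
    moreover have "\<sigma> m < k - u" if "m \<in> {u+2..k}" for m
      using right[of m] upper[of m] that uk by auto
    moreover have "\<sigma> u = k - u" "\<sigma> (u + 1) = k - u + 1"
      using u uk upper[of u] upper[of "u + 1"] by auto
    ultimately show "u \<in> ascent_blocks k \<sigma>"
      using u uk by (auto simp: ascent_blocks_def)
  next
    fix u assume "u \<in> ascent_blocks k \<sigma>"
    then have u: "1 \<le> u" "u + 1 \<le> k" "\<sigma> u = k - u" "\<sigma> (u + 1) = k - u + 1"
      and left: "\<And>m. m \<in> {1..<u} \<Longrightarrow> k - u + 1 < \<sigma> m"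
      and right: "\<And>m. m \<in> {u+2..k} \<Longrightarrow> \<sigma> m < k - u"
      by (auto simp: ascent_blocks_def)
    have "k + l + 2 - u + 1 < ?\<pi> m" if "m \<in> {1..<u}" for m
      using left[OF that] upper[of m] that u by auto
    moreover have "?\<pi> m < k + l + 2 - u" if "m \<in> {u+2..k+l+2}" for m
      using right[of m] upper[of m] lower[of m] that u by (cases "m \<le> k") auto
    moreover have "?\<pi> u = k + l + 2 - u" "?\<pi> (u + 1) = k + l + 2 - u + 1"
      using u upper[of u] upper[of "u + 1"] by auto
    ultimately show "u \<in> {u \<in> ascent_blocks (k + l + 2) ?\<pi>. u < k + 1}"
      using u by (auto simp: ascent_blocks_def)
  }
qed

lemma earlier_blocks_parts:
  assumes "\<pi> \<in> perms (k + l + 2)" "k + 1 \<in> ascent_blocks (k + l + 2) \<pi>"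
  shows "{u \<in> ascent_blocks (k + l + 2) \<pi>. u < k + 1} = ascent_blocks k (upper_part k l \<pi>)"
  using earlier_blocks_glue[OF parts_in_perms[OF assms]] by (simp only: glue_parts[OF assms])

section \<open>The generating function\<close>

text \<open>
  The ranks \<open>card {u \<in> S. u < s}\<close> of the elements \<open>s\<close> of \<open>S\<close> are \<open>0, \<dots>, card S - 1\<close>, so this is the
  finite geometric series, written as a sum over \<open>S\<close> itself.
\<close>

lemma power_card_telescope:
  fixes q :: "'a::comm_ring_1" and S :: "nat set"
  assumes "finite S"
  shows "q ^ card S = 1 + (q - 1) * (\<Sum>s\<in>S. q ^ card {u \<in> S. u < s})"
  using assms
proof (induction S rule: finite_linorder_max_induct)
  case (insert b A)
  let ?f = "\<lambda>S s. q ^ card {u \<in> S. u < s}"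
  have b: "b \<notin> A" and "{u \<in> insert b A. u < b} = A"
    using insert by auto
  moreover have "(\<Sum>s\<in>A. ?f (insert b A) s) = (\<Sum>s\<in>A. ?f A s)"
  proof (rule sum.cong)
    fix s assume "s \<in> A"
    then have "{u \<in> insert b A. u < s} = {u \<in> A. u < s}" using insert by auto
    then show "?f (insert b A) s = ?f A s" by (simp only:)
  qed simp
  ultimately have "(\<Sum>s\<in>insert b A. ?f (insert b A) s) = q ^ card A + (\<Sum>s\<in>A. ?f A s)"
    using insert.hyps by (simp only: sum.insert not_False_eq_True)
  then have "1 + (q - 1) * (\<Sum>s\<in>insert b A. ?f (insert b A) s)
      = (1 + (q - 1) * (\<Sum>s\<in>A. ?f A s)) + (q - 1) * q ^ card A"
    by (simp only: distrib_left ac_simps)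
  also have "\<dots> = q ^ card A + (q - 1) * q ^ card A"
    by (simp only: insert.IH[symmetric])
  also have "\<dots> = q ^ card (insert b A)"
    using insert.hyps b by (simp add: left_diff_distrib)
  finally show ?case by (rule sym)
qed simp

text \<open>
  Permutations with a marked block at \<open>k + 1\<close> correspond to pairs \<open>(\<sigma>, \<tau>)\<close>. The weight sees only the
  blocks left of the mark, hence only \<open>\<sigma>\<close>, and so \<open>\<tau>\<close> contributes a factorial.
\<close>

lemma sum_at_block:
  fixes q :: "'a::comm_ring_1"
  shows "(\<Sum>\<pi> | \<pi> \<in> perms (k + l + 2) \<and> k + 1 \<in> ascent_blocks (k + l + 2) \<pi>.
            q ^ card {u \<in> ascent_blocks (k + l + 2) \<pi>. u < k + 1})
         = (\<Sum>\<sigma>\<in>perms k. q ^ card (ascent_blocks k \<sigma>)) * of_nat (fact l)"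
proof -
  have "(\<Sum>\<pi> | \<pi> \<in> perms (k + l + 2) \<and> k + 1 \<in> ascent_blocks (k + l + 2) \<pi>.
            q ^ card {u \<in> ascent_blocks (k + l + 2) \<pi>. u < k + 1})
      = (\<Sum>(\<sigma>, \<tau>)\<in>perms k \<times> perms l. q ^ card (ascent_blocks k \<sigma>))"
    by (rule sum.reindex_bij_witness[where
          i = "\<lambda>(\<sigma>, \<tau>). glue k l \<sigma> \<tau>" and j = "\<lambda>\<pi>. (upper_part k l \<pi>, lower_part k l \<pi>)"])
      (auto simp: glue_parts[simplified] parts_glue parts_in_perms[simplified]
        glue_in_perms[simplified] glue_block[simplified] earlier_blocks_parts[simplified])
  also have "\<dots> = (\<Sum>\<sigma>\<in>perms k. q ^ card (ascent_blocks k \<sigma>)) * of_nat (fact l)"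
    by (simp flip: sum.cartesian_product add: card_perms sum_distrib_left mult.commute)
  finally show ?thesis .
qed

text \<open>
  Telescoping the weight of each permutation and then exchanging the sums over permutations and over
  marked blocks. The marked block is at position \<open>k + 1\<close>, so that \<open>k\<close> is the length of the left factor.
\<close>

lemma distribution_recurrence:
  fixes q :: "'a::comm_ring_1"
  shows "(\<Sum>\<pi>\<in>perms (N + 2). q ^ card (ascent_blocks (N + 2) \<pi>)) =
     of_nat (fact (N + 2)) + (q - 1) *
       (\<Sum>k=0..N. (\<Sum>\<sigma>\<in>perms k. q ^ card (ascent_blocks k \<sigma>)) * of_nat (fact (N - k)))"
proof -
  let ?B = "ascent_blocks (N + 2)"
  let ?w = "\<lambda>\<pi> s. q ^ card {u \<in> ?B \<pi>. u < s}"
  have "(\<Sum>\<pi>\<in>perms (N + 2). \<Sum>s\<in>?B \<pi>. ?w \<pi> s)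
      = (\<Sum>\<pi>\<in>perms (N + 2). \<Sum>k | k \<in> {0..N} \<and> k + 1 \<in> ?B \<pi>. ?w \<pi> (k + 1))"
    by (intro sum.cong refl sum.reindex_bij_witness[of _ "\<lambda>k. k + 1" "\<lambda>s. s - 1"])
      (auto simp: ascent_blocks_def)
  also have "\<dots> = (\<Sum>k\<in>{0..N}. \<Sum>\<pi> | \<pi> \<in> perms (N + 2) \<and> k + 1 \<in> ?B \<pi>. ?w \<pi> (k + 1))"
    by (rule sum.swap_restrict) auto
  also have "\<dots> = (\<Sum>k=0..N. (\<Sum>\<sigma>\<in>perms k. q ^ card (ascent_blocks k \<sigma>)) * of_nat (fact (N - k)))"
  proof (rule sum.cong)
    fix k assume "k \<in> {0..N}"
    then show "(\<Sum>\<pi> | \<pi> \<in> perms (N + 2) \<and> k + 1 \<in> ?B \<pi>. ?w \<pi> (k + 1))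
      = (\<Sum>\<sigma>\<in>perms k. q ^ card (ascent_blocks k \<sigma>)) * of_nat (fact (N - k))"
      using sum_at_block[where k = k and l = "N - k" and q = q] by simp
  qed simp
  finally have swap: "(\<Sum>\<pi>\<in>perms (N + 2). \<Sum>s\<in>?B \<pi>. ?w \<pi> s)
      = (\<Sum>k=0..N. (\<Sum>\<sigma>\<in>perms k. q ^ card (ascent_blocks k \<sigma>)) * of_nat (fact (N - k)))" .
  have "(\<Sum>\<pi>\<in>perms (N + 2). q ^ card (?B \<pi>))
      = (\<Sum>\<pi>\<in>perms (N + 2). 1 + (q - 1) * (\<Sum>s\<in>?B \<pi>. ?w \<pi> s))"
    by (intro sum.cong refl power_card_telescope) simp
  also have "\<dots> = of_nat (fact (N + 2)) + (q - 1) * (\<Sum>\<pi>\<in>perms (N + 2). \<Sum>s\<in>?B \<pi>. ?w \<pi> s)"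
    by (simp only: sum.distrib sum_distrib_left) (simp add: card_perms)
  finally show ?thesis unfolding swap .
qed

unbundle fps_syntax

lemma distribution_fps_equation:
  fixes q :: "'a::comm_ring_1"
  assumes R: "R = {(0, 0), (0, 1), (1, 0), (1, 1), (1, 2), (2, 1), (2, 2)}"
  shows "mesh12_distribution_fps R q * (1 + fps_const (1 - q) * fps_X\<^sup>2 * perms_fps) = perms_fps"
proof -
  let ?D = "mesh12_distribution_fps R q"
  have D: "?D $ n = (\<Sum>\<pi>\<in>perms n. q ^ card (ascent_blocks n \<pi>))" for n
    by (simp add: mesh12_distribution_fps_def mesh12_count_conv_blocks[OF R])
  have recurrence: "?D = perms_fps + fps_const (q - 1) * (fps_X\<^sup>2 * (?D * perms_fps))"
  proof (rule fps_ext)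
    fix n
    show "?D $ n = (perms_fps + fps_const (q - 1) * (fps_X\<^sup>2 * (?D * perms_fps))) $ n"
    proof (cases "n < 2")
      case True
      then have "ascent_blocks n \<pi> = {}" for \<pi>
        by (auto simp: ascent_blocks_def)
      with True show ?thesis
        by (simp add: D card_perms perms_fps_def fps_X_power_mult_nth)
    next
      case False
      then obtain N where "n = N + 2"
        by (metis add.commute le_Suc_ex not_less)
      then have "(fps_const (q - 1) * (fps_X\<^sup>2 * (?D * perms_fps))) $ n
          = (q - 1) * (?D * perms_fps) $ N"
        by (simp add: fps_X_power_mult_nth del: fps_const_sub)
      also have "(?D * perms_fps) $ N
          = (\<Sum>k=0..N. (\<Sum>\<sigma>\<in>perms k. q ^ card (ascent_blocks k \<sigma>)) * of_nat (fact (N - k)))"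
        by (simp add: fps_mult_nth D perms_fps_def)
      finally have product: "(fps_const (q - 1) * (fps_X\<^sup>2 * (?D * perms_fps))) $ n = (q - 1) * \<dots>" .
      have fact: "perms_fps $ n = (of_nat (fact n) :: 'a)"
        by (simp add: perms_fps_def)
      show ?thesis
        unfolding fps_add_nth product fact D unfolding \<open>n = N + 2\<close>
        by (rule distribution_recurrence)
    qed
  qed
  have "fps_const (1 - q) = - fps_const (q - 1)"
    by simp
  then have "?D * (1 + fps_const (1 - q) * fps_X\<^sup>2 * perms_fps)
      = ?D - fps_const (q - 1) * (fps_X\<^sup>2 * (?D * perms_fps))"
    by (simp only: distrib_left mult_minus_left mult_minus_right mult_1_left mult_1_right ac_simps
        diff_conv_add_uminus)
  also have "\<dots> = perms_fps"
    by (subst (1) recurrence) (rule add_diff_cancel_right')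
  finally show ?thesis .
qed

text \<open>The denominator has constant term \<open>1\<close>, so it may be divided out.\<close>

lemma distribution_fps_quotient:
  fixes q :: "'a::field"
  assumes "R = {(0, 0), (0, 1), (1, 0), (1, 1), (1, 2), (2, 1), (2, 2)}"
  shows "mesh12_distribution_fps R q =
    perms_fps / (1 + fps_const (1 - q) * fps_X\<^sup>2 * perms_fps)"
proof -
  let ?G = "1 + fps_const (1 - q) * fps_X\<^sup>2 * perms_fps :: 'a fps"
  have "?G $ 0 = 1"
    by (simp add: mult.assoc fps_X_power_mult_nth)
  then have "?G \<noteq> 0" by (metis fps_zero_nth zero_neq_one)
  then have "mesh12_distribution_fps R q = mesh12_distribution_fps R q * ?G / ?G"
    by (rule nonzero_mult_div_cancel_right[symmetric])
  also have "mesh12_distribution_fps R q * ?G = perms_fps"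
    by (rule distribution_fps_equation[OF assms])
  finally show ?thesis .
qed

text \<open>As \<open>0 ^ 0 = 1\<close>, at \<open>q = 0\<close> exactly the avoiding permutations have nonzero weight.\<close>

lemma avoiders_fps_conv_distribution:
  "(mesh12_avoiders_fps R :: 'a::comm_ring_1 fps) = mesh12_distribution_fps R 0"
proof (rule fps_ext)
  fix n
  have "(\<Sum>\<pi>\<in>perms n. (0::'a) ^ mesh12_count R n \<pi>) = (\<Sum>\<pi>\<in>mesh12_avoiders R n. 1)"
    unfolding mesh12_avoiders_def by (rule sum.mono_neutral_cong_right) (auto simp: power_0_left)
  then show "(mesh12_avoiders_fps R :: 'a fps) $ n = mesh12_distribution_fps R 0 $ n"
    by (simp add: mesh12_avoiders_fps_def mesh12_distribution_fps_def)
qed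

theorem theorem3p7:
  fixes R :: "(nat \<times> nat) set"
  assumes "R = {(0, 0), (0, 1), (1, 0), (1, 1), (1, 2), (2, 1), (2, 2)}"
  shows "(mesh12_avoiders_fps R :: rat fps) = perms_fps / (1 + fps_X\<^sup>2 * perms_fps)
    \<and> mesh12_distribution_fps R q_var =
        perms_fps / (1 + fps_const (1 - q_var) * fps_X\<^sup>2 * perms_fps)"
  using distribution_fps_quotient[OF assms, of "0::rat"] distribution_fps_quotient[OF assms, of q_var]
  by (simp add: avoiders_fps_conv_distribution)

end
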